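(* Let $Z_+=\begin{bmatrix}z_1&\dots&z_n&z_{n+1}\end{bmatrix}=\begin{bmatrix}Z&z_{n+1}\end{bmatrix}\in\mathbf{R}^{n\times(n+1)}$ have as columns the vertices of any regular simplex in $\mathbf{R}^n$ with radius $h>0$ and centroid $z_0$, and let $f_j=f(z_j)$, $j=1,\dots,n+1$, be known function values. Let $\alpha=\sqrt{\frac{n+1}{n}}$, $\mathbf{f}=(f_1,\dots,f_n)^T$, and $$u=\frac{1}{\alpha^2h^2}\left(\mathbf{f}-f_{n+1}e\right).$$ Then the simplex gradient is $$g=Zu-(e^Tu)z_0,$$ which can be calculated in $\mathcal{O}(n^2)$ floating point operations.
   Context: $e$ denotes the all-ones vector in $\mathbf{R}^n$. A regular simplex in $\mathbf{R}^n$ is the convex hull of $n+1$ affinely independent points $z_1,\dots,z_{n+1}$ (its vertices) any two of which are at the same distance from each other; its centroid is $z_0=\frac1{n+1}\sum_{j=1}^{n+1}z_j$, and its radius is the common distance $h=\|z_j-z_0\|_2$, $j=1,\dots,n+1$. The simplex gradient is the unique $g\in\mathbf{R}^n$ satisfying the interpolation conditions $(z_j-z_{n+1})^Tg=f_j-f_{n+1}$ for $j=1,\dots,n$. The operation count assumes that $Z$, $z_0$, $h$ and the function values are given, and counts scalar arithmetic operations. *)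

theory Defs
  imports "Jordan_Normal_Form.Matrix" "HOL-Library.Landau_Symbols"
begin

text \<open>The dimension \<open>n\<close> is quantified inside the statement (it is the parameter of an asymptotic
  bound), so \<open>\<real>\<^sup>n\<close> is \<^term>\<open>carrier_vec n :: real vec set\<close>. A simplex is given by the
  \<open>n \<times> (n + 1)\<close> matrix of its vertices. Indices start at 0: the columns \<open>0, \<dots>, n - 1\<close> are
  the mathematical \<open>z\<^sub>1, \<dots>, z\<^sub>n\<close>, and column \<open>n\<close> is \<open>z\<^bsub>n+1\<^esub>\<close>.\<close>

definition ones_vec :: "nat \<Rightarrow> real vec" where
  "ones_vec n = vec n (\<lambda>_. 1)"

definition norm_2 :: "real vec \<Rightarrow> real" where
  "norm_2 v = sqrt (v \<bullet> v)"

text \<open>Affine independence of the family of columns (in particular, the columns are distinct):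
  the only coefficients \<open>c\<close> with \<open>\<Sum>j. c\<^sub>j = 0\<close> and \<open>\<Sum>j. c\<^sub>j z\<^sub>j = 0\<close> are zero.\<close>

definition affinely_independent_cols :: "real mat \<Rightarrow> bool" where
  "affinely_independent_cols A \<longleftrightarrow>
     (\<forall>c \<in> carrier_vec (dim_col A).
        (\<Sum>j<dim_col A. c $ j) = 0 \<and> A *\<^sub>v c = 0\<^sub>v (dim_row A) \<longrightarrow> c = 0\<^sub>v (dim_col A))"

definition regular_simplex :: "nat \<Rightarrow> real mat \<Rightarrow> bool" where
  "regular_simplex n Zp \<longleftrightarrow>
     Zp \<in> carrier_mat n (n + 1) \<and> affinely_independent_cols Zp \<and>
     (\<exists>d. \<forall>i\<le>n. \<forall>j\<le>n. i \<noteq> j \<longrightarrow> norm_2 (col Zp i - col Zp j) = d)"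

definition centroid :: "nat \<Rightarrow> real mat \<Rightarrow> real vec" where
  "centroid n Zp = (1 / real (n + 1)) \<cdot>\<^sub>v finsum_vec TYPE(real) n (col Zp) {..n}"

definition interpolates :: "nat \<Rightarrow> real mat \<Rightarrow> (real vec \<Rightarrow> real) \<Rightarrow> real vec \<Rightarrow> bool" where
  "interpolates n Zp f g \<longleftrightarrow>
     g \<in> carrier_vec n \<and>
     (\<forall>j<n. (col Zp j - col Zp n) \<bullet> g = f (col Zp j) - f (col Zp n))"

definition is_simplex_gradient :: "nat \<Rightarrow> real mat \<Rightarrow> (real vec \<Rightarrow> real) \<Rightarrow> real vec \<Rightarrow> bool" where
  "is_simplex_gradient n Zp f g \<longleftrightarrow>
     interpolates n Zp f g \<and> (\<forall>g'. interpolates n Zp f g' \<longrightarrow> g' = g)"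

text \<open>Operation counts refer to straight-line programs over the reals in exact arithmetic. The
  memory initially holds the given data; every instruction performs one scalar operation and appends
  its result to the memory. Integer literals are free, as is addressing. Accessing an
  unused memory location or dividing by zero makes the program fail (\<^const>\<open>None\<close>).\<close>

datatype arith_op = Add | Sub | Mul | Div

datatype operand = Lit int | Loc nat

datatype instr = Instr arith_op operand operand

datatype slp = SLP (slp_instrs: "instr list") (slp_outputs: "operand list")

definition flops :: "slp \<Rightarrow> nat" where
  "flops P = length (slp_instrs P)"

fun operand_val :: "real list \<Rightarrow> operand \<Rightarrow> real option" where
  "operand_val m (Lit k) = Some (of_int k)"
| "operand_val m (Loc i) = (if i < length m then Some (m ! i) else None)"

fun op_val :: "arith_op \<Rightarrow> real \<Rightarrow> real \<Rightarrow> real option" where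
  "op_val Add x y = Some (x + y)"
| "op_val Sub x y = Some (x - y)"
| "op_val Mul x y = Some (x * y)"
| "op_val Div x y = (if y = 0 then None else Some (x / y))"

fun exec :: "instr list \<Rightarrow> real list \<Rightarrow> real list option" where
  "exec [] m = Some m"
| "exec (Instr b s t # is) m =
     Option.bind (operand_val m s) (\<lambda>x.
     Option.bind (operand_val m t) (\<lambda>y.
     Option.bind (op_val b x y) (\<lambda>r. exec is (m @ [r]))))"

definition run_slp :: "slp \<Rightarrow> real list \<Rightarrow> real list option" where
  "run_slp P inp =
     Option.bind (exec (slp_instrs P) inp) (\<lambda>m. those (map (operand_val m) (slp_outputs P)))"

text \<open>The data the computation starts from: \<open>Z\<close> (row by row), \<open>z\<^sub>0\<close>, \<open>h\<close>, the function values
  \<open>f\<^sub>1, \<dots>, f\<^sub>n\<close> and \<open>f\<^bsub>n+1\<^esub>\<close>; that is \<open>n * n + 2 * n + 2\<close> numbers.\<close>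

definition slp_input ::
    "nat \<Rightarrow> real mat \<Rightarrow> real vec \<Rightarrow> real \<Rightarrow> real vec \<Rightarrow> real \<Rightarrow> real list" where
  "slp_input n Z z0 h fv fn1 =
     map (\<lambda>k. Z $$ (k div n, k mod n)) [0..<n * n] @ list_of_vec z0 @ [h] @ list_of_vec fv @ [fn1]"

end

theory Submission
  imports Defs "Jordan_Normal_Form.Determinant"
begin

text \<open>The vectors \<open>y\<^sub>j = z\<^sub>j - z\<^sub>0\<close> sum to zero, have norm \<open>h\<close> and equal pairwise distances, so all
  their pairwise inner products coincide, and expanding \<open>y\<^sub>j \<bullet> (\<Sum>i. y\<^sub>i) = 0\<close> shows that the common
  value is \<open>- h\<^sup>2 / n\<close>. As \<open>g = (\<Sum>j<n. u\<^sub>j y\<^sub>j)\<close>, the product of \<open>g\<close> with \<open>z\<^sub>k - z\<^bsub>n+1\<^esub> = y\<^sub>k - y\<^bsub>n+1\<^esub>\<close>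
  collapses to \<open>u\<^sub>k (h\<^sup>2 + h\<^sup>2 / n) = \<alpha>\<^sup>2 h\<^sup>2 u\<^sub>k\<close>. The interpolation conditions have only one solution
  because the edge vectors \<open>z\<^sub>j - z\<^bsub>n+1\<^esub>\<close> are linearly independent.

  For the operation count, \<open>g\<close> is the product of the \<open>n \<times> (n + 1)\<close> matrix \<open>[Z z\<^sub>0]\<close> with the vector
  \<open>(u, - e\<^sup>Tu)\<close>.\<close>

subsection \<open>The simplex gradient\<close>

lemma centroid_carrier:
  assumes "Zp \<in> carrier_mat n (n + 1)"
  shows "centroid n Zp \<in> carrier_vec n"
  unfolding centroid_def using assms finsum_vec_closed[of "col Zp" "{..n}" n] by auto

lemma sum_centered_cols:
  assumes Zp: "Zp \<in> carrier_mat n (n + 1)" and k: "k < n"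
  shows "(\<Sum>j\<le>n. (col Zp j - centroid n Zp) $ k) = 0"
proof -
  have cols: "col Zp \<in> {..n} \<rightarrow> carrier_vec n"
    using Zp by auto
  have dim: "finsum_vec TYPE(real) n (col Zp) {..n} \<in> carrier_vec n"
    by (rule finsum_vec_closed[OF cols])
  have "centroid n Zp $ k = (1 / real (n + 1)) * (\<Sum>j\<le>n. col Zp j $ k)"
    using k dim index_finsum_vec[OF _ k cols] by (simp add: centroid_def)
  then have "(\<Sum>j\<le>n. col Zp j $ k) = real (n + 1) * centroid n Zp $ k"
    by (simp del: of_nat_add)
  moreover have "(col Zp j - centroid n Zp) $ k = col Zp j $ k - centroid n Zp $ k" for j
    using centroid_carrier[OF Zp] k by simp
  ultimately show ?thesis
    by (simp add: sum_subtractf)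
qed

lemma norm_2_eq_iff: "norm_2 v = h \<longleftrightarrow> h \<ge> 0 \<and> v \<bullet> v = h\<^sup>2"
proof -
  have "v \<bullet> v \<ge> 0"
    by (simp add: scalar_prod_def sum_nonneg)
  then show ?thesis
    unfolding norm_2_def by (metis real_sqrt_ge_zero real_sqrt_pow2 real_sqrt_unique)
qed

text \<open>Polarization expresses every mixed product through \<open>h\<close> and
  \<open>D\<close>, so all of them agree; pairing one vector with the vanishing total then
  determines their value. Here \<open>D\<close> is a squared distance.\<close>

lemma scalar_prod_centered_equidistant:
  fixes y :: "nat \<Rightarrow> real vec"
  assumes n: "n \<ge> 1"
    and y: "\<And>j. j \<le> n \<Longrightarrow> y j \<in> carrier_vec n"
    and centered: "\<And>k. k < n \<Longrightarrow> (\<Sum>j\<le>n. y j $ k) = 0"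
    and radius: "\<And>j. j \<le> n \<Longrightarrow> y j \<bullet> y j = h\<^sup>2"
    and dist: "\<And>i j. i \<le> n \<Longrightarrow> j \<le> n \<Longrightarrow> i \<noteq> j \<Longrightarrow> (y i - y j) \<bullet> (y i - y j) = D"
    and ij: "i \<le> n" "j \<le> n" "i \<noteq> j"
  shows "y i \<bullet> y j = - h\<^sup>2 / n"
proof -
  \<comment> \<open>Solves |y_i - y_j|^2 = 2 h^2 - 2 (y_i . y_j) = \<open>D\<close> for the mixed
    product.\<close>
  define c where "c = h\<^sup>2 - D / 2"
  have c: "y j \<bullet> y i = c" if "i \<le> n" "j \<le> n" "i \<noteq> j" for i j
  proof -
    have "(y i - y j) \<bullet> (y i - y j) = y i \<bullet> y i - y j \<bullet> y i - (y i \<bullet> y j - y j \<bullet> y j)"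
      using y[of i] y[of j] that
      by (simp add: minus_scalar_prod_distrib[of _ n] scalar_prod_minus_distrib[of _ n])
    moreover have "y i \<bullet> y j = y j \<bullet> y i"
      using y that by (intro comm_scalar_prod[of _ n]) auto
    ultimately show ?thesis
      using dist[of i j] radius that by (simp add: c_def field_simps)
  qed
  have "(\<Sum>l\<le>n. y i \<bullet> y l) = (\<Sum>l\<le>n. \<Sum>k<n. y i $ k * y l $ k)"
    by (intro sum.cong) (auto simp: scalar_prod_def lessThan_atLeast0 carrier_vecD[OF y])
  also have "\<dots> = (\<Sum>k<n. y i $ k * (\<Sum>l\<le>n. y l $ k))"
    by (subst sum.swap) (simp add: sum_distrib_left)
  also have "\<dots> = 0"
    using centered by simp
  finally have "0 = (\<Sum>l\<le>n. y i \<bullet> y l)"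
    by simp
  \<comment> \<open>The diagonal term contributes h^2, and each of the \<open>n\<close> remaining
    indices contributes \<open>c\<close>.\<close>
  also have "\<dots> = y i \<bullet> y i + (\<Sum>l\<in>{..n} - {i}. y i \<bullet> y l)"
    using ij by (intro sum.remove) auto
  also have "(\<Sum>l\<in>{..n} - {i}. y i \<bullet> y l) = (\<Sum>l\<in>{..n} - {i}. c)"
    using c ij by (intro sum.cong) auto
  also have "\<dots> = n * c"
    using ij by simp
  finally have "h\<^sup>2 + n * c = 0"
    using radius ij by simp
  then show ?thesis
    using c[of j i] ij n by (simp add: field_simps)
qed

text \<open>Affine independence makes the square matrix of edge vectors injective, hence its
  transpose as well; orthogonality of \<open>d\<close> to all edges says that this transpose maps
  \<open>d\<close> to zero.\<close>

lemma affinely_independent_edges_orthogonal: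
  assumes Zp: "Zp \<in> carrier_mat n (n + 1)"
    and ind: "affinely_independent_cols Zp"
    and d: "d \<in> carrier_vec n"
    and orth: "\<And>j. j < n \<Longrightarrow> (col Zp j - col Zp n) \<bullet> d = 0"
  shows "d = 0\<^sub>v n"
proof -
  define M where "M = mat n n (\<lambda>(i, j). Zp $$ (i, j) - Zp $$ (i, n))"
  have M: "M \<in> carrier_mat n n"
    by (simp add: M_def)
  have "v = 0\<^sub>v n" if v: "v \<in> carrier_vec n" and Mv: "M *\<^sub>v v = 0\<^sub>v n" for v
  proof -
    \<comment> \<open>A kernel vector of \<open>M\<close> becomes a coefficient vector with sum zero
      once minus its total is assigned to the last vertex, which is the form that affine
      independence refers to.\<close>
    define c where "c = vec (n + 1) (\<lambda>j. if j < n then v $ j else - (\<Sum>j<n. v $ j))"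
    have "(\<Sum>j<n+1. c $ j) = 0"
      by (simp add: c_def)
    moreover have "Zp *\<^sub>v c = 0\<^sub>v n"
    proof (rule eq_vecI)
      fix i assume "i < dim_vec (0\<^sub>v n :: real vec)"
      then have i: "i < n" by simp
      have "(Zp *\<^sub>v c) $ i = (\<Sum>j<n+1. Zp $$ (i, j) * c $ j)"
        using Zp i by (auto simp: scalar_prod_def c_def lessThan_atLeast0 intro!: sum.cong)
      also have "\<dots> = (\<Sum>j<n. (Zp $$ (i, j) - Zp $$ (i, n)) * v $ j)"
        by (simp add: c_def sum_distrib_left sum_subtractf left_diff_distrib)
      also have "\<dots> = (M *\<^sub>v v) $ i"
        using v i by (auto simp: M_def scalar_prod_def lessThan_atLeast0 intro!: sum.cong)
      finally show "(Zp *\<^sub>v c) $ i = 0\<^sub>v n $ i"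
        by (simp add: Mv)
    qed (use Zp in auto)
    ultimately have "c = 0\<^sub>v (n + 1)"
      using ind Zp unfolding affinely_independent_cols_def by (auto simp: c_def)
    then have "c $ j = 0" if "j < n" for j
      using that by simp
    then show ?thesis
      using v by (auto simp: c_def)
  qed
  \<comment> \<open>The determinant carries the trivial kernel over from \<open>M\<close> to its
    transpose.\<close>
  then have "det M \<noteq> 0"
    using det_0_iff_vec_prod_zero[OF M] by blast
  then have det: "det (transpose_mat M) \<noteq> 0"
    using det_transpose[OF M] by simp
  have "transpose_mat M *\<^sub>v d = 0\<^sub>v n"
  proof (rule eq_vecI)
    fix j assume "j < dim_vec (0\<^sub>v n :: real vec)"
    then have j: "j < n" by simp
    have "col M j = col Zp j - col Zp n"
      using Zp j by (auto simp: M_def)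
    then show "(transpose_mat M *\<^sub>v d) $ j = 0\<^sub>v n $ j"
      using orth[OF j] j M by simp
  qed (use M in auto)
  then show ?thesis
    using det det_0_iff_vec_prod_zero[of "transpose_mat M" n] M d by auto
qed

text \<open>Writing \<open>g\<close> as a combination of the centered vertices with weights
  \<open>w\<close> lets their Gram matrix decouple the interpolation conditions: the one for vertex
  \<open>k\<close> involves only \<open>w k\<close>.\<close>

lemma regular_simplex_interpolates:
  assumes n: "n \<ge> 1"
    and simplex: "regular_simplex n Zp"
    and h: "h > 0"
    and radius: "\<forall>j\<le>n. norm_2 (col Zp j - centroid n Zp) = h"
    and g: "g \<in> carrier_vec n"
    and g_nth: "\<And>i. i < n \<Longrightarrow> g $ i = (\<Sum>j<n. w j * (Zp $$ (i, j) - centroid n Zp $ i))"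
    and w: "\<And>j. j < n \<Longrightarrow> w j = (f (col Zp j) - f (col Zp n)) / ((real n + 1) / n * h\<^sup>2)"
  shows "interpolates n Zp f g"
proof -
  define y where "y j = col Zp j - centroid n Zp" for j
  have Zp: "Zp \<in> carrier_mat n (n + 1)"
    using simplex by (simp add: regular_simplex_def)
  have z0: "centroid n Zp \<in> carrier_vec n"
    by (rule centroid_carrier[OF Zp])
  have y: "y j \<in> carrier_vec n" if "j \<le> n" for j
    using Zp z0 that by (auto simp: y_def)
  have rad: "y j \<bullet> y j = h\<^sup>2" if "j \<le> n" for j
    using radius that by (simp add: y_def norm_2_eq_iff)
  have diff: "col Zp i - col Zp j = y i - y j" if "i \<le> n" "j \<le> n" for i j
    using Zp z0 that by (auto simp: y_def)
  obtain D where D: "\<And>i j. i \<le> n \<Longrightarrow> j \<le> n \<Longrightarrow> i \<noteq> j \<Longrightarrow> norm_2 (col Zp i - col Zp j) = D"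
    using simplex unfolding regular_simplex_def by blast
  have gram: "y i \<bullet> y j = - h\<^sup>2 / n" if "i \<le> n" "j \<le> n" "i \<noteq> j" for i j
  proof (rule scalar_prod_centered_equidistant[where y = y and D = "D\<^sup>2"])
    show "(\<Sum>j\<le>n. y j $ k) = 0" if "k < n" for k
      unfolding y_def by (rule sum_centered_cols[OF Zp that])
    show "(y i - y j) \<bullet> (y i - y j) = D\<^sup>2" if "i \<le> n" "j \<le> n" "i \<noteq> j" for i j
      using D[OF that] diff[of i j] that by (simp add: norm_2_eq_iff)
  qed (use n y rad that in auto)
  have "(col Zp k - col Zp n) \<bullet> g = f (col Zp k) - f (col Zp n)" if k: "k < n" for k
  proof -
    have "(y k - y n) \<bullet> g = (\<Sum>i<n. (y k - y n) $ i * (\<Sum>j<n. w j * y j $ i))"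
      using g g_nth Zp z0 by (auto simp: scalar_prod_def y_def lessThan_atLeast0 intro!: sum.cong)
    also have "\<dots> = (\<Sum>j<n. w j * (\<Sum>i<n. (y k - y n) $ i * y j $ i))"
      unfolding sum_distrib_left by (subst sum.swap) (simp add: mult.left_commute)
    also have "\<dots> = (\<Sum>j<n. w j * ((y k - y n) \<bullet> y j))"
    proof (intro sum.cong refl)
      fix j assume "j \<in> {..<n}"
      then have "y j \<in> carrier_vec n"
        using y by simp
      then show "w j * (\<Sum>i<n. (y k - y n) $ i * y j $ i) = w j * ((y k - y n) \<bullet> y j)"
        by (simp add: scalar_prod_def lessThan_atLeast0)
    qed
    \<comment> \<open>For \<open>j\<close> different from \<open>k\<close>, both y_k . y_j and y_n .
      y_j equal -h^2/n and cancel; \<open>j\<close> is never \<open>n\<close>, as the sum stops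
      before the last vertex. For \<open>j = k\<close> the difference is h^2 + h^2/n.\<close>
    also have "\<dots> = (\<Sum>j<n. if j = k then w k * (h\<^sup>2 + h\<^sup>2 / n) else 0)"
    proof (intro sum.cong refl)
      fix j assume "j \<in> {..<n}"
      moreover from this have "(y k - y n) \<bullet> y j = y k \<bullet> y j - y n \<bullet> y j"
        using y k by (intro minus_scalar_prod_distrib) auto
      ultimately show "w j * ((y k - y n) \<bullet> y j) = (if j = k then w k * (h\<^sup>2 + h\<^sup>2 / n) else 0)"
        using gram[of n j] gram[of k j] rad[of k] k by auto
    qed
    \<comment> \<open>The factor is \<alpha>^2 h^2, exactly the denominator of
      \<open>w k\<close>.\<close>
    also have "\<dots> = w k * ((real n + 1) / n * h\<^sup>2)"
      using k n by (simp add: field_simps)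
    also have "\<dots> = f (col Zp k) - f (col Zp n)"
      using w[OF k] n h by simp
    finally show ?thesis
      using diff k by simp
  qed
  then show ?thesis
    using g by (simp add: interpolates_def)
qed

text \<open>The difference of two solutions is orthogonal to every edge at the last vertex.\<close>

lemma interpolates_unique:
  assumes "regular_simplex n Zp" "interpolates n Zp f g" "interpolates n Zp f g'"
  shows "g' = g"
proof -
  have Zp: "Zp \<in> carrier_mat n (n + 1)" and ind: "affinely_independent_cols Zp"
    using assms by (auto simp: regular_simplex_def)
  have g: "g \<in> carrier_vec n" "g' \<in> carrier_vec n"
    using assms by (auto simp: interpolates_def)
  have "(col Zp j - col Zp n) \<bullet> (g' - g) = 0" if "j < n" for j
  proof -
    have "col Zp j - col Zp n \<in> carrier_vec n"
      using Zp that by auto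
    then have "(col Zp j - col Zp n) \<bullet> (g' - g)
        = (col Zp j - col Zp n) \<bullet> g' - (col Zp j - col Zp n) \<bullet> g"
      using g by (intro scalar_prod_minus_distrib) auto
    then show ?thesis
      using assms that by (simp add: interpolates_def)
  qed
  then have "g' - g = 0\<^sub>v n"
    using g by (intro affinely_independent_edges_orthogonal[OF Zp ind]) auto
  then have "(g' - g) $ i = 0" if "i < n" for i
    using that by simp
  then show ?thesis
    using g by (intro eq_vecI) auto
qed

subsection \<open>Straight-line programs built from blocks of equal length\<close>

lemma exec_append: "exec (is @ js) m = Option.bind (exec is m) (exec js)"
proof (induction "is" arbitrary: m)
  case (Cons i "is")
  then show ?case
    by (cases i) (simp add: bind_assoc)
qed simp

text \<open>Memory only grows, so later blocks can still read the input and earlier results at their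
  old addresses.\<close>

lemma operand_val_append:
  "operand_val m s = Some x \<Longrightarrow> operand_val (m @ w) s = Some x"
  by (cases s) (auto simp: nth_append split: if_splits)

lemma those_map_Some:
  "(\<And>x. x \<in> set xs \<Longrightarrow> F x = Some (G x)) \<Longrightarrow> those (map F xs) = Some (map G xs)"
  by (induction xs) auto

text \<open>A loop rule: block \<open>i\<close> appends exactly \<open>L\<close> cells and leaves
  its result \<open>v i\<close> in the last of them, so results sit at predictable offsets. A block
  may use the results of earlier blocks, which is how accumulators are handled.\<close>

lemma exec_concat_blocks:
  assumes L: "L > 0"
    and block: "\<And>i w. i < k \<Longrightarrow> length w = L * i \<Longrightarrow>
      (\<And>i'. i' < i \<Longrightarrow> w ! (L * i' + L - 1) = v i') \<Longrightarrow>
      \<exists>w'. length w' = L \<and> exec (B i) (m @ w) = Some (m @ w @ w') \<and> w' ! (L - 1) = v i"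
  shows "\<exists>w. length w = L * k \<and> exec (concat (map B [0..<k])) m = Some (m @ w) \<and>
    (\<forall>i<k. w ! (L * i + L - 1) = v i)"
  using block
proof (induction k)
  case (Suc k)
  then obtain w where w: "length w = L * k" "exec (concat (map B [0..<k])) m = Some (m @ w)"
      "\<And>i. i < k \<Longrightarrow> w ! (L * i + L - 1) = v i"
    using less_SucI by metis
  from Suc.prems[OF lessI w(1) w(3)] obtain w' where
    w': "length w' = L" "exec (B k) (m @ w) = Some (m @ w @ w')" "w' ! (L - 1) = v k"
    by blast
  have "(w @ w') ! (L * i + L - 1) = v i" if i: "i < Suc k" for i
  proof (cases "i = k")
    case True
    then have "L * i + L - 1 = length w + (L - 1)"
      using w(1) L by simp
    then show ?thesis
      using w'(3) True by (simp only: nth_append_length_plus)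
  next
    case False
    \<comment> \<open>Block \<open>i\<close> ends no later than block \<open>k\<close> begins, so
      its result lies inside \<open>w\<close>.\<close>
    then have "L * Suc i \<le> L * k"
      using i by (intro mult_le_mono2) simp
    then have "L * i + L - 1 < length w"
      using w(1) L by simp
    then show ?thesis
      using w(3)[of i] False i by (simp add: nth_append)
  qed
  then show ?case
    using w w' by (intro exI[of _ "w @ w'"]) (simp add: exec_append)
qed simp

text \<open>Here \<open>b\<close> is meant to be the memory length at the start. Step
  \<open>i\<close> puts the product in cell \<open>b + 2 * i\<close> and the partial sum in the next
  one; the previous partial sum is therefore in cell \<open>b + 2 * i - 1\<close>. The free literal
  0 starts the accumulation, which keeps all blocks at length 2.\<close>

definition dot_prog :: "nat \<Rightarrow> nat \<Rightarrow> (nat \<Rightarrow> operand) \<Rightarrow> (nat \<Rightarrow> operand) \<Rightarrow> instr list" where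
  "dot_prog b k s t = concat (map (\<lambda>i.
     [Instr Mul (s i) (t i),
      Instr Add (if i = 0 then Lit 0 else Loc (b + 2 * i - 1)) (Loc (b + 2 * i))]) [0..<k])"

lemma length_dot_prog: "length (dot_prog b k s t) = 2 * k"
  unfolding dot_prog_def by (induction k) auto

lemma exec_dot_prog:
  assumes b: "length m = b" and k: "k > 0"
    and st: "\<And>i. i < k \<Longrightarrow> operand_val m (s i) = Some (x i)"
      "\<And>i. i < k \<Longrightarrow> operand_val m (t i) = Some (y i)"
  shows "\<exists>w. length w = 2 * k \<and> exec (dot_prog b k s t) m = Some (m @ w) \<and>
    w ! (2 * k - 1) = (\<Sum>i<k. x i * y i)"
proof -
  have "\<exists>w. length w = 2 * k \<and> exec (dot_prog b k s t) m = Some (m @ w) \<and>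
    (\<forall>i<k. w ! (2 * i + 2 - 1) = (\<Sum>j<Suc i. x j * y j))"
    unfolding dot_prog_def
  proof (rule exec_concat_blocks)
    fix i and w :: "real list"
    assume i: "i < k" and w: "length w = 2 * i"
      "\<And>i'. i' < i \<Longrightarrow> w ! (2 * i' + 2 - 1) = (\<Sum>j<Suc i'. x j * y j)"
    have ops: "operand_val (m @ w) (s i) = Some (x i)" "operand_val (m @ w) (t i) = Some (y i)"
      using operand_val_append st i by auto
    \<comment> \<open>At \<open>i = 0\<close> the literal 0 is the empty sum; otherwise the
      accumulator is the last cell of block \<open>i - 1\<close>.\<close>
    have acc: "operand_val (m @ w @ [z]) (if i = 0 then Lit 0 else Loc (b + 2 * i - 1)) =
        Some (\<Sum>j<i. x j * y j)" for z
    proof (cases i)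
      case (Suc l)
      then show ?thesis
        using w(1) w(2)[of l] b by (simp add: nth_append)
    qed simp
    have prod: "operand_val (m @ w @ [z]) (Loc (b + 2 * i)) = Some z" for z
      using b w(1) by (simp add: nth_append)
    show "\<exists>w'. length w' = 2 \<and>
      exec [Instr Mul (s i) (t i),
        Instr Add (if i = 0 then Lit 0 else Loc (b + 2 * i - 1)) (Loc (b + 2 * i))] (m @ w)
        = Some (m @ w @ w') \<and>
      w' ! (2 - 1) = (\<Sum>j<Suc i. x j * y j)"
      using ops acc prod
      by (intro exI[of _ "[x i * y i, \<Sum>j<Suc i. x j * y j]"]) (simp del: operand_val.simps)
  qed simp
  then obtain w where "length w = 2 * k" "exec (dot_prog b k s t) m = Some (m @ w)"
    "\<And>i. i < k \<Longrightarrow> w ! (2 * i + 2 - 1) = (\<Sum>j<Suc i. x j * y j)"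
    by blast
  moreover from this(3)[of "k - 1"] have "w ! (2 * k - 1) = (\<Sum>i<k. x i * y i)"
    using k by (cases k) simp_all
  ultimately show ?thesis
    by blast
qed

subsection \<open>A program for the simplex gradient\<close>

text \<open>Memory layout: \<open>b\<close> input cells; three cells for h^2, (n+1) h^2 and
  \<alpha>^2 h^2, so no square root is taken; \<open>n\<close> pairs of f_j - f_{n+1} and u_j;
  \<open>2 * n\<close> cells whose last, \<open>c - 1\<close>, is minus the sum of the u_j; finally
  one inner product of length \<open>n + 1\<close> per component of the gradient.\<close>

definition gradient_prog :: "nat \<Rightarrow> slp" where
  "gradient_prog n = (let
     b = n * n + 2 * n + 2;
     u = (\<lambda>j. Loc (b + 3 + 2 * j + 1));
     c = b + 3 + 4 * n
   in SLP
     ([Instr Mul (Loc (n * n + n)) (Loc (n * n + n)),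
       Instr Mul (Lit (int n + 1)) (Loc b),
       Instr Div (Loc (b + 1)) (Lit (int n))] @
      concat (map (\<lambda>j.
        [Instr Sub (Loc (n * n + n + 1 + j)) (Loc (n * n + 2 * n + 1)),
         Instr Div (Loc (b + 3 + 2 * j)) (Loc (b + 2))]) [0..<n]) @
      dot_prog (b + 3 + 2 * n) n (\<lambda>_. Lit (- 1)) u @
      concat (map (\<lambda>i. dot_prog (c + 2 * (n + 1) * i) (n + 1)
        (\<lambda>j. if j < n then Loc (i * n + j) else Loc (n * n + i))
        (\<lambda>j. if j < n then u j else Loc (c - 1))) [0..<n]))
     (map (\<lambda>i. Loc (c + 2 * (n + 1) * i + 2 * (n + 1) - 1)) [0..<n]))"

text \<open>The four phases cost 3, 2n, 2n and n * 2(n+1) operations.\<close>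

lemma flops_gradient_prog: "flops (gradient_prog n) = 2 * n\<^sup>2 + 6 * n + 3"
proof -
  have "length (concat (map B [0..<n])) = L * n" if "\<And>i. length (B i) = L"
    for L and B :: "nat \<Rightarrow> instr list"
    using that by (simp add: length_concat comp_def sum_list_triv)
  note len = this
  show ?thesis
    unfolding gradient_prog_def Let_def flops_def
    by (simp add: length_dot_prog len[of _ 2] len[of _ "2 * (n + 1)"] power2_eq_square)
qed

lemma flops_gradient_prog_bigo: "(\<lambda>n. real (flops (gradient_prog n))) \<in> O(\<lambda>n. real n ^ 2)"
proof (rule bigoI)
  \<comment> \<open>The constant is 2 + 6 + 3, since both \<open>n\<close> and 1 are at most n^2
    once \<open>n\<close> is positive.\<close>
  show "\<forall>\<^sub>F n in sequentially. norm (real (flops (gradient_prog n))) \<le> 11 * norm (real n ^ 2)"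
    using eventually_ge_at_top[of 1]
  proof eventually_elim
    case (elim n)
    then have "n * 1 \<le> n * n" "1 * 1 \<le> n * n"
      by (intro mult_le_mono; simp)+
    then have "2 * n\<^sup>2 + 6 * n + 3 \<le> 11 * n\<^sup>2"
      unfolding power2_eq_square by linarith
    then have "flops (gradient_prog n) \<le> 11 * n\<^sup>2"
      by (simp only: flops_gradient_prog)
    then have "real (flops (gradient_prog n)) \<le> real (11 * n\<^sup>2)"
      by (rule of_nat_mono)
    then show ?case
      by simp
  qed
qed

lemma slp_input_nth:
  assumes "dim_vec z0 = n" "dim_vec fv = n"
  shows "length (slp_input n Z z0 h fv fn1) = n * n + 2 * n + 2"
    and "i < n \<Longrightarrow> j < n \<Longrightarrow> slp_input n Z z0 h fv fn1 ! (i * n + j) = Z $$ (i, j)"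
    and "i < n \<Longrightarrow> slp_input n Z z0 h fv fn1 ! (n * n + i) = z0 $ i"
    and "slp_input n Z z0 h fv fn1 ! (n * n + n) = h"
    and "i < n \<Longrightarrow> slp_input n Z z0 h fv fn1 ! (n * n + n + 1 + i) = fv $ i"
    and "slp_input n Z z0 h fv fn1 ! (n * n + 2 * n + 1) = fn1"
proof -
  show "slp_input n Z z0 h fv fn1 ! (i * n + j) = Z $$ (i, j)" if "i < n" "j < n"
  proof -
    \<comment> \<open>Row-major addresses stay within the first \<open>n * n\<close> cells, before
      \<open>z0\<close> begins.\<close>
    have "i * n + j < Suc i * n"
      using that by simp
    also have "\<dots> \<le> n * n"
      using that by (intro mult_le_mono1) simp
    finally show ?thesis
      using that by (simp add: slp_input_def nth_append)
  qed
qed (use assms in \<open>simp_all add: slp_input_def nth_append list_of_vec_index\<close>)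

text \<open>Follows the memory through the phases: \<open>m0\<close> is the input, \<open>m1\<close>
  adds the denominator, \<open>m2\<close> the vector \<open>u\<close>, \<open>m3\<close> its negated
  sum, and \<open>w4\<close> the row products.\<close>

lemma run_gradient_prog:
  assumes n: "n \<ge> 1" and h: "h \<noteq> 0"
    and dims: "dim_vec z0 = n" "dim_vec fv = n"
    and u: "\<And>j. j < n \<Longrightarrow> u j = (fv $ j - fn1) / ((real n + 1) / n * h\<^sup>2)"
  shows "run_slp (gradient_prog n) (slp_input n Z z0 h fv fn1) =
    Some (map (\<lambda>i. (\<Sum>j<n. Z $$ (i, j) * u j) - (\<Sum>j<n. u j) * z0 $ i) [0..<n])"
proof -
  define m0 where "m0 = slp_input n Z z0 h fv fn1"
  define b where "b = n * n + 2 * n + 2"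
  define c where "c = b + 3 + 4 * n"
  define U where "U j = Loc (b + 3 + 2 * j + 1)" for j
  define den where "den = (real n + 1) / n * h\<^sup>2"
  define res where "res i = (\<Sum>j<n. Z $$ (i, j) * u j) - (\<Sum>j<n. u j) * z0 $ i" for i
  define P1 where "P1 = [Instr Mul (Loc (n * n + n)) (Loc (n * n + n)),
    Instr Mul (Lit (int n + 1)) (Loc b), Instr Div (Loc (b + 1)) (Lit (int n))]"
  define B2 where "B2 j = [Instr Sub (Loc (n * n + n + 1 + j)) (Loc (n * n + 2 * n + 1)),
    Instr Div (Loc (b + 3 + 2 * j)) (Loc (b + 2))]" for j
  define P3 where "P3 = dot_prog (b + 3 + 2 * n) n (\<lambda>_. Lit (- 1)) U"
  define B4 where "B4 i = dot_prog (c + 2 * (n + 1) * i) (n + 1)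
    (\<lambda>j. if j < n then Loc (i * n + j) else Loc (n * n + i))
    (\<lambda>j. if j < n then U j else Loc (c - 1))" for i
  have prog: "gradient_prog n = SLP (P1 @ concat (map B2 [0..<n]) @ P3 @ concat (map B4 [0..<n]))
      (map (\<lambda>i. Loc (c + 2 * (n + 1) * i + 2 * (n + 1) - 1)) [0..<n])"
    unfolding gradient_prog_def Let_def P1_def B2_def P3_def B4_def U_def c_def b_def ..
  note inp = slp_input_nth[where Z = Z and h = h and ?fn1.0 = fn1, OF dims, folded m0_def b_def]
  have den: "den \<noteq> 0"
    using n h by (simp add: den_def)

  define m1 where "m1 = m0 @ [h * h, (real n + 1) * (h * h), den]"
  have "n * n + n < b"
    by (simp add: b_def)
  then have "exec P1 m0 = Some m1"
    using inp(1,4) n by (simp add: P1_def m1_def den_def nth_append power2_eq_square)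
  have len1: "length m1 = b + 3"
    using inp(1) by (simp add: m1_def)

  have "\<exists>w. length w = 2 * n \<and> exec (concat (map B2 [0..<n])) m1 = Some (m1 @ w) \<and>
    (\<forall>i<n. w ! (2 * i + 2 - 1) = u i)"
  proof (rule exec_concat_blocks)
    fix i and w :: "real list" assume i: "i < n" and w: "length w = 2 * i"
    have vals: "operand_val (m1 @ w) (Loc (n * n + n + 1 + i)) = Some (fv $ i)"
        "operand_val (m1 @ w) (Loc (n * n + 2 * n + 1)) = Some fn1"
      using inp(1) inp(5)[OF i] inp(6) i by (auto simp: m1_def nth_append b_def)
    have vals': "operand_val (m1 @ w @ [z]) (Loc (b + 3 + 2 * i)) = Some z"
        "operand_val (m1 @ w @ [z]) (Loc (b + 2)) = Some den" for z
      using inp(1) len1 w by (auto simp: m1_def nth_append)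
    show "\<exists>w'. length w' = 2 \<and> exec (B2 i) (m1 @ w) = Some (m1 @ w @ w') \<and> w' ! (2 - 1) = u i"
      using vals vals' den u[OF i, folded den_def]
      by (intro exI[of _ "[fv $ i - fn1, u i]"])
        (simp add: B2_def del: operand_val.simps)
  qed simp
  then obtain w2 where w2: "length w2 = 2 * n"
      "exec (concat (map B2 [0..<n])) m1 = Some (m1 @ w2)"
      "\<And>i. i < n \<Longrightarrow> w2 ! (2 * i + 1) = u i"
    by auto
  define m2 where "m2 = m1 @ w2"
  have len2: "length m2 = b + 3 + 2 * n"
    using len1 w2 by (simp add: m2_def)
  have U: "operand_val m2 (U j) = Some (u j)" if "j < n" for j
    using that w2 len1 by (simp add: m2_def U_def nth_append)

  have "\<exists>w. length w = 2 * n \<and> exec P3 m2 = Some (m2 @ w) \<and>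
      w ! (2 * n - 1) = (\<Sum>i<n. (- 1) * u i)"
    unfolding P3_def using n U by (intro exec_dot_prog len2) auto
  then obtain w3 where w3: "length w3 = 2 * n" "exec P3 m2 = Some (m2 @ w3)"
      "w3 ! (2 * n - 1) = - (\<Sum>i<n. u i)"
    by (auto simp: sum_negf)
  define m3 where "m3 = m2 @ w3"
  have len3: "length m3 = c"
    using len2 w3 by (simp add: m3_def c_def)
  \<comment> \<open>The input is still a prefix of the memory, so its original addresses remain
    valid.\<close>
  have m3: "m3 = m0 @ drop b m3"
    using inp(1) by (simp add: m3_def m2_def m1_def)
  have in3: "operand_val m3 (Loc k) = Some (m0 ! k)" if "k < b" for k
    using that inp(1) by (subst m3) (simp add: nth_append)
  have s: "operand_val m3 (Loc (c - 1)) = Some (- (\<Sum>i<n. u i))"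
    using len2 w3 n by (simp add: m3_def nth_append c_def)

  have "\<exists>w. length w = 2 * (n + 1) * n \<and> exec (concat (map B4 [0..<n])) m3 = Some (m3 @ w) \<and>
    (\<forall>i<n. w ! (2 * (n + 1) * i + 2 * (n + 1) - 1) = res i)"
  proof (rule exec_concat_blocks)
    fix i and w :: "real list" assume i: "i < n" and w: "length w = 2 * (n + 1) * i"
    \<comment> \<open>Row \<open>i\<close> of the matrix [Z z0] and the vector (u, -e^T u); their
      product is component \<open>i\<close> of the gradient.\<close>
    define x where "x j = (if j < n then Z $$ (i, j) else z0 $ i)" for j
    define y where "y j = (if j < n then u j else - (\<Sum>i<n. u i))" for j
    have "\<exists>w'. length w' = 2 * (n + 1) \<and> exec (B4 i) (m3 @ w) = Some ((m3 @ w) @ w') \<and>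
        w' ! (2 * (n + 1) - 1) = (\<Sum>j<n+1. x j * y j)"
      unfolding B4_def
    proof (rule exec_dot_prog)
      fix j assume j: "j < n + 1"
      have idx: "i * n + j < b" if "j < n"
      proof -
        have "i * n + j < Suc i * n"
          using that by simp
        also have "\<dots> \<le> n * n"
          using i by (intro mult_le_mono1) simp
        finally show ?thesis
          by (simp add: b_def)
      qed
      have "n * n + i < b"
        using i by (simp add: b_def)
      then show "operand_val (m3 @ w) (if j < n then Loc (i * n + j) else Loc (n * n + i)) = Some (x j)"
        using idx in3 inp(2)[OF i, of j] inp(3)[OF i]
        by (intro operand_val_append) (simp add: x_def del: operand_val.simps)
      show "operand_val (m3 @ w) (if j < n then U j else Loc (c - 1)) = Some (y j)"
        using s operand_val_append[OF U, of j w3]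
        by (intro operand_val_append) (simp add: y_def m3_def del: operand_val.simps)
    qed (use len3 w in auto)
    moreover have "(\<Sum>j<n+1. x j * y j) = res i"
      by (simp add: x_def y_def res_def)
    ultimately show "\<exists>w'. length w' = 2 * (n + 1) \<and> exec (B4 i) (m3 @ w) = Some (m3 @ w @ w') \<and>
        w' ! (2 * (n + 1) - 1) = res i"
      by simp
  qed simp
  then obtain w4 where w4: "length w4 = 2 * (n + 1) * n"
      "exec (concat (map B4 [0..<n])) m3 = Some (m3 @ w4)"
      "\<And>i. i < n \<Longrightarrow> w4 ! (2 * (n + 1) * i + 2 * (n + 1) - 1) = res i"
    by blast
  have out: "operand_val (m3 @ w4) (Loc (c + 2 * (n + 1) * i + 2 * (n + 1) - 1)) = Some (res i)"
    if i: "i < n" for i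
  proof -
    define k where "k = 2 * (n + 1) * i + 2 * (n + 1) - 1"
    \<comment> \<open>The output cell is the last cell of row block \<open>i\<close>, hence it lies
      within \<open>w4\<close>.\<close>
    have "2 * (n + 1) * Suc i \<le> 2 * (n + 1) * n"
      using i by (intro mult_le_mono2) simp
    then have "k < length w4"
      unfolding k_def w4(1) by simp
    moreover have "c + 2 * (n + 1) * i + 2 * (n + 1) - 1 = c + k"
      by (simp add: k_def)
    ultimately show ?thesis
      using w4(3)[OF i, folded k_def] len3 by (simp add: nth_append)
  qed
  have "exec (slp_instrs (gradient_prog n)) m0 = Some (m3 @ w4)"
    using \<open>exec P1 m0 = Some m1\<close> w2(2) w3(2) w4(2)
    by (simp add: prog exec_append m2_def m3_def)
  moreover have "those (map (operand_val (m3 @ w4)) (slp_outputs (gradient_prog n))) =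
      Some (map res [0..<n])"
    unfolding prog slp.sel map_map by (intro those_map_Some) (simp only: comp_apply out set_upt atLeastLessThan_iff)
  ultimately show ?thesis
    unfolding run_slp_def m0_def[symmetric] by (simp add: res_def)
qed

theorem theorem5:
  shows "\<exists>P :: nat \<Rightarrow> slp.
    (\<lambda>n. real (flops (P n))) \<in> O(\<lambda>n. real n ^ 2) \<and>
    (\<forall>(n :: nat) (Zp :: real mat) (Z :: real mat) (z0 :: real vec) (h :: real)
       (f :: real vec \<Rightarrow> real) (fv :: real vec) (fn1 :: real) (\<alpha> :: real)
       (u :: real vec) (g :: real vec).
       n \<ge> 1 \<longrightarrow>
       regular_simplex n Zp \<longrightarrow>
       Z = mat_of_cols n (map (col Zp) [0..<n]) \<longrightarrow>
       z0 = centroid n Zp \<longrightarrow>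
       h > 0 \<longrightarrow>
       (\<forall>j\<le>n. norm_2 (col Zp j - z0) = h) \<longrightarrow>
       fv = vec n (\<lambda>j. f (col Zp j)) \<longrightarrow>
       fn1 = f (col Zp n) \<longrightarrow>
       \<alpha> = sqrt ((real n + 1) / real n) \<longrightarrow>
       u = (1 / (\<alpha>\<^sup>2 * h\<^sup>2)) \<cdot>\<^sub>v (fv - fn1 \<cdot>\<^sub>v ones_vec n) \<longrightarrow>
       g = Z *\<^sub>v u - (ones_vec n \<bullet> u) \<cdot>\<^sub>v z0 \<longrightarrow>
       is_simplex_gradient n Zp f g \<and>
       run_slp (P n) (slp_input n Z z0 h fv fn1) = Some (list_of_vec g))"
proof (intro exI conjI allI impI)
  \<comment> \<open>The program is fixed here, before any simplex data, and depends on
    \<open>n\<close> alone.\<close>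
  show "(\<lambda>n. real (flops (gradient_prog n))) \<in> O(\<lambda>n. real n ^ 2)"
    by (rule flops_gradient_prog_bigo)
next
  fix n :: nat and Zp Z :: "real mat" and z0 fv u g :: "real vec" and h fn1 \<alpha> :: real
    and f :: "real vec \<Rightarrow> real"
  assume n: "n \<ge> 1" and simplex: "regular_simplex n Zp"
    and Z: "Z = mat_of_cols n (map (col Zp) [0..<n])"
    and z0: "z0 = centroid n Zp" and h: "h > 0"
    and radius: "\<forall>j\<le>n. norm_2 (col Zp j - z0) = h"
    and fv: "fv = vec n (\<lambda>j. f (col Zp j))" and fn1: "fn1 = f (col Zp n)"
    and \<alpha>: "\<alpha> = sqrt ((real n + 1) / real n)"
    and u: "u = (1 / (\<alpha>\<^sup>2 * h\<^sup>2)) \<cdot>\<^sub>v (fv - fn1 \<cdot>\<^sub>v ones_vec n)"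
    and g: "g = Z *\<^sub>v u - (ones_vec n \<bullet> u) \<cdot>\<^sub>v z0"
  have Zp: "Zp \<in> carrier_mat n (n + 1)"
    using simplex by (simp add: regular_simplex_def)
  have "dim_vec u = n" "Z \<in> carrier_mat n n"
    by (simp_all add: u ones_vec_def Z mat_of_cols_def)
  moreover have dims: "dim_vec z0 = n" "dim_vec fv = n"
    using carrier_vecD[OF centroid_carrier[OF Zp]] by (simp_all add: z0 fv)
  ultimately have dim_Zu: "dim_vec u = n" "dim_row Z = n" "dim_col Z = n"
    by simp_all
  have Z_nth: "Z $$ (i, j) = Zp $$ (i, j)" if "i < n" "j < n" for i j
    using Zp that by (simp add: Z mat_of_cols_index)
  have u_nth: "u $ j = (fv $ j - fn1) / ((real n + 1) / n * h\<^sup>2)" if "j < n" for j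
    using that n by (simp add: u \<alpha> fv ones_vec_def)
  have g_carrier: "g \<in> carrier_vec n"
    using dims by (intro carrier_vecI) (simp add: g)
  have g_nth: "g $ i = (\<Sum>j<n. Z $$ (i, j) * u $ j) - (\<Sum>j<n. u $ j) * z0 $ i" if "i < n" for i
    using that dims dim_Zu by (simp add: g scalar_prod_def ones_vec_def lessThan_atLeast0)
  have "interpolates n Zp f g"
  proof (rule regular_simplex_interpolates[OF n simplex h])
    show "\<forall>j\<le>n. norm_2 (col Zp j - centroid n Zp) = h"
      using radius z0 by simp
    \<comment> \<open>Distributing e^T u over \<open>z0\<close> turns Zu - (e^T u) z0 into the
      combination of the centered vertices with weights \<open>u\<close>.\<close>
    show "g $ i = (\<Sum>j<n. u $ j * (Zp $$ (i, j) - centroid n Zp $ i))" if "i < n" for i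
      using that by (simp add: g_nth Z_nth z0 sum_distrib_right sum_subtractf algebra_simps)
    show "u $ j = (f (col Zp j) - f (col Zp n)) / ((real n + 1) / n * h\<^sup>2)" if "j < n" for j
      using u_nth[OF that] that by (simp add: fv fn1)
  qed (rule g_carrier)
  then show "is_simplex_gradient n Zp f g"
    unfolding is_simplex_gradient_def using interpolates_unique[OF simplex] by blast
  have "list_of_vec g =
      map (\<lambda>i. (\<Sum>j<n. Z $$ (i, j) * u $ j) - (\<Sum>j<n. u $ j) * z0 $ i) [0..<n]"
    using g_carrier g_nth by (intro nth_equalityI) (auto simp: list_of_vec_index)
  then show "run_slp (gradient_prog n) (slp_input n Z z0 h fv fn1) = Some (list_of_vec g)"
    using run_gradient_prog[OF n _ dims u_nth] h by simp
qed

end
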